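(* Let $v\in\mathbb{R}^d$. For $j=1,\dots,s$ let $A_j\in\mathbb{S}^d$ with $A_j\succeq0$, $b_j\in\mathbb{R}^d$, $r_j\in\mathbb{R}$, and let $$\mathcal{D}_{\mathrm{quad}}=\{x\in\mathbb{R}^d:\ x^\top A_jx+b_j^\top x+r_j\le0,\ j=1,\dots,s\}.$$ If $(u^v,S^v)\in\mathbb{R}^d\times\mathbb{S}^d$ is a solution of the semidefinite program $$\min_{S\in\mathbb{S}^d,\,u\in\mathbb{R}^d}\Big\{\mathrm{tr}(S)-2v^\top u+\|v\|_2^2:\ \begin{bmatrix} 1 & u^\top \\ u & S \end{bmatrix}\succeq0,\ \ \mathrm{tr}(A_jS)+b_j^\top u+r_j\le0,\ j=1,\dots,s\Big\},$$ then $P_{\mathcal{D}_{\mathrm{quad}}}(v)=u^v$.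
   Context: $\mathbb{S}^d$ is the space of real symmetric $d\times d$ matrices, $M\succeq0$ means $M$ is symmetric positive semidefinite, and $P_{A}$ denotes the Euclidean projection onto a closed convex set $A\subseteq\mathbb{R}^d$. *)

theory Defs
  imports "HOL-Analysis.Analysis"
begin

definition symmetric_matrix :: "real^'n^'n \<Rightarrow> bool" where
  "symmetric_matrix M \<longleftrightarrow> transpose M = M"

definition psd :: "real^'n^'n \<Rightarrow> bool" where
  "psd M \<longleftrightarrow> symmetric_matrix M \<and> (\<forall>x. 0 \<le> x \<bullet> (M *v x))"

definition quad_region ::
  "nat \<Rightarrow> (nat \<Rightarrow> real^'d^'d) \<Rightarrow> (nat \<Rightarrow> real^'d) \<Rightarrow> (nat \<Rightarrow> real) \<Rightarrow> (real^'d) set" where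
  "quad_region s A b r = {x. \<forall>j\<in>{1..s}. x \<bullet> (A j *v x) + b j \<bullet> x + r j \<le> 0}"

text \<open>The block matrix with rows (1, u^T) and (u, S): row and column Inl () come first,
  Inr i is the i-th row or column of the remaining block.\<close>

definition bordered_matrix :: "real^'d \<Rightarrow> real^'d^'d \<Rightarrow> real^(unit + 'd)^(unit + 'd)" where
  "bordered_matrix u S = (\<chi> p q. case p of
      Inl _ \<Rightarrow> (case q of Inl _ \<Rightarrow> 1 | Inr j \<Rightarrow> u $ j)
    | Inr i \<Rightarrow> (case q of Inl _ \<Rightarrow> u $ i | Inr j \<Rightarrow> S $ i $ j))"

definition sdp_feasible ::
  "nat \<Rightarrow> (nat \<Rightarrow> real^'d^'d) \<Rightarrow> (nat \<Rightarrow> real^'d) \<Rightarrow> (nat \<Rightarrow> real) \<Rightarrow>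
   (real^'d) \<times> (real^'d^'d) \<Rightarrow> bool" where
  "sdp_feasible s A b r = (\<lambda>(u, S). symmetric_matrix S \<and> psd (bordered_matrix u S) \<and>
     (\<forall>j\<in>{1..s}. trace (A j ** S) + b j \<bullet> u + r j \<le> 0))"

definition sdp_objective :: "real^'d \<Rightarrow> (real^'d) \<times> (real^'d^'d) \<Rightarrow> real" where
  "sdp_objective v = (\<lambda>(u, S). trace S - 2 * (v \<bullet> u) + (norm v)\<^sup>2)"

end

theory Submission
  imports Defs
begin

text \<open>
  The semidefinite program is an exact relaxation of the projection problem. A point \<open>x\<close> of the
  region gives the feasible pair \<open>(x, x x\<^sup>T)\<close> (\<open>sdp_feasible_outer\<close>), whose objective value is
  the squared distance from \<open>x\<close> to \<open>v\<close>. Conversely, for a feasible pair \<open>(u, S)\<close> the Schur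
  complement \<open>S - u u\<^sup>T\<close> of the corner entry 1 is positive semidefinite
  (\<open>psd_bordered_matrix_imp_psd_schur\<close>). Since the trace of a product of two positive
  semidefinite matrices is nonnegative (\<open>trace_mult_psd_nonneg\<close>), replacing \<open>S\<close> by
  \<open>u u\<^sup>T\<close> can only decrease each \<open>tr (A\<^sub>j S)\<close> and \<open>tr S\<close>. Hence \<open>u\<close> lies in the region, and
  its squared distance to \<open>v\<close> is at most the objective value of \<open>(u, S)\<close>. For an optimal pair,
  \<open>u\<close> is therefore a nearest point of the region, and this point is unique because the region
  is closed and convex.

  The trace inequality is obtained without diagonalization: eliminating one row and column at a
  time writes a positive semidefinite matrix as a sum of matrices \<open>w w\<^sup>T\<close>, for which
  \<open>tr (A w w\<^sup>T) = w\<^sup>T A w\<close>. The elimination step is the same Schur complement that is used for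
  the bordered matrix.
\<close>

section \<open>Rank-one matrices\<close>

definition outer :: "real^'n \<Rightarrow> real^'n^'n" where
  "outer w = (\<chi> i j. w $ i * w $ j)"

lemma outer_mult_vec: "outer w *v x = (w \<bullet> x) *\<^sub>R w"
  by (simp add: outer_def matrix_vector_mult_def inner_vec_def vec_eq_iff sum_distrib_left
      mult_ac)

lemma psd_outer: "psd (outer w)"
  by (auto simp: psd_def symmetric_matrix_def outer_mult_vec inner_commute)
     (simp add: outer_def transpose_def vec_eq_iff mult.commute)

lemma trace_mult_outer: "trace (A ** outer w) = w \<bullet> (A *v w)"
  by (simp add: trace_def matrix_matrix_mult_def outer_def inner_vec_def
      matrix_vector_mult_def sum_distrib_left mult_ac)

lemma trace_mult_diff: "trace (A ** (S - T)) = trace (A ** S) - trace (A ** (T :: real^'n^'n))"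
  by (simp add: matrix_matrix_mult_def trace_def right_diff_distrib sum_subtractf)

section \<open>Positive semidefinite matrices\<close>

lemma symmetric_matrix_entry: "symmetric_matrix M \<Longrightarrow> M $ i $ j = M $ j $ i"
  unfolding symmetric_matrix_def transpose_def by (metis vec_lambda_beta)

lemma symmetric_matrix_inner:
  assumes "symmetric_matrix M"
  shows "x \<bullet> (M *v y) = y \<bullet> (M *v x)"
proof -
  have "x \<bullet> (M *v y) = (x v* M) \<bullet> y" by (simp only: dot_lmul_matrix)
  also have "x v* M = M *v x"
    using assms transpose_matrix_vector[of M x] by (simp add: symmetric_matrix_def)
  finally show ?thesis by (simp only: inner_commute)
qed

text \<open>The quadratic form along the line through \<open>x\<close> in a coordinate direction is a
  one-variable quadratic; both the Schur complement and the vanishing of rows with zero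
  diagonal entry come from its nonnegativity.\<close>

lemma quadratic_form_along_axis:
  fixes M :: "real^'n^'n"
  assumes "symmetric_matrix M"
  shows "(x + t *\<^sub>R axis k 1) \<bullet> (M *v (x + t *\<^sub>R axis k 1)) =
    x \<bullet> (M *v x) + 2 * t * (M $ k \<bullet> x) + t\<^sup>2 * M $ k $ k"
proof -
  have e: "axis k 1 \<bullet> (M *v y) = M $ k \<bullet> y" for y
    by (simp add: inner_axis' matrix_vector_mul_component)
  have c: "x \<bullet> (M *v axis k 1) = M $ k \<bullet> x"
    using symmetric_matrix_inner[OF assms, of x "axis k 1"] e by simp
  show ?thesis
    by (simp add: matrix_vector_right_distrib matrix_vector_mult_scaleR inner_add_left
        inner_add_right e c inner_axis power2_eq_square algebra_simps)
qed

lemma psd_zero_diagonal_imp_zero_row: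
  assumes "psd M" and "M $ k $ k = 0"
  shows "M $ k = 0"
proof (rule ccontr)
  assume "M $ k \<noteq> 0"
  then have p: "M $ k \<bullet> M $ k > 0" by simp
  define x where "x = M $ k"
  \<comment> \<open>The form is affine in \<open>t\<close> with slope \<open>2 (x \<bullet> x)\<close>; this \<open>t\<close> makes its value \<open>- 1\<close>.\<close>
  define t where "t = - (x \<bullet> (M *v x) + 1) / (2 * (x \<bullet> x))"
  have "0 \<le> x \<bullet> (M *v x) + 2 * t * (x \<bullet> x)"
  proof -
    have "0 \<le> (x + t *\<^sub>R axis k 1) \<bullet> (M *v (x + t *\<^sub>R axis k 1))"
      using assms(1) by (simp only: psd_def)
    then show ?thesis
      using assms by (simp add: quadratic_form_along_axis psd_def x_def)
  qed
  also have "2 * t * (x \<bullet> x) = - (x \<bullet> (M *v x) + 1)"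
    using p by (simp add: t_def x_def)
  finally show False by simp
qed

text \<open>Minimizing the form over \<open>x + t e\<^sub>k\<close> in \<open>t\<close> gives the value of the Schur complement's form
  at \<open>x\<close>.\<close>

lemma psd_schur_complement:
  assumes "psd M" and pos: "M $ k $ k > 0"
  shows "psd (M - outer ((1 / sqrt (M $ k $ k)) *\<^sub>R (M $ k)))" (is "psd (M - outer ?w)")
proof -
  have sym: "symmetric_matrix M" using assms by (simp add: psd_def)
  have "0 \<le> x \<bullet> ((M - outer ?w) *v x)" for x
  proof -
    define t where "t = - (M $ k \<bullet> x) / M $ k $ k"
    have "0 \<le> x \<bullet> (M *v x) + 2 * t * (M $ k \<bullet> x) + t\<^sup>2 * M $ k $ k"
      unfolding quadratic_form_along_axis[OF sym, symmetric]
      using assms(1) by (simp only: psd_def)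
    also have "\<dots> = x \<bullet> (M *v x) - (M $ k \<bullet> x)\<^sup>2 / M $ k $ k"
      using pos by (simp add: t_def field_simps power2_eq_square)
    also have "(M $ k \<bullet> x)\<^sup>2 / M $ k $ k = x \<bullet> (outer ?w *v x)"
      using pos by (simp add: outer_mult_vec inner_commute power2_eq_square)
    finally show ?thesis
      by (simp add: matrix_vector_mult_diff_rdistrib inner_diff_right)
  qed
  moreover have "symmetric_matrix (M - outer ?w)"
    using sym psd_outer[of ?w]
    by (simp add: psd_def symmetric_matrix_def transpose_def vec_eq_iff)
  ultimately show ?thesis by (simp add: psd_def)
qed

text \<open>Induction on the number of nonzero rows: passing to the Schur complement clears row \<open>k\<close>,
  keeps zero rows zero, and changes the trace by a value of the form of \<open>A\<close>.\<close>

lemma trace_mult_psd_nonneg: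
  fixes A C :: "real^'n^'n"
  assumes A: "psd A" and "psd C"
  shows "0 \<le> trace (A ** C)"
  using \<open>psd C\<close>
proof (induction "card {i. C $ i \<noteq> 0}" arbitrary: C rule: less_induct)
  case less
  show ?case
  proof (cases "C = 0")
    case True
    then show ?thesis by (simp add: trace_def matrix_matrix_mult_def)
  next
    case False
    then obtain k where k: "C $ k \<noteq> 0" by (metis vec_eq_iff zero_index)
    have "C $ k $ k \<noteq> 0" using psd_zero_diagonal_imp_zero_row[OF less.prems] k by blast
    moreover have "0 \<le> C $ k $ k"
    proof -
      have "C $ k $ k = axis k 1 \<bullet> (C *v axis k 1)"
        by (simp add: inner_axis' matrix_vector_mul_component inner_axis)
      then show ?thesis using less.prems by (simp only: psd_def)
    qed
    ultimately have pos: "C $ k $ k > 0" by simp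
    define w where "w = (1 / sqrt (C $ k $ k)) *\<^sub>R (C $ k)"
    define D where "D = C - outer w"
    have D: "psd D" unfolding D_def w_def by (rule psd_schur_complement[OF less.prems pos])
    have sym: "symmetric_matrix C" using less.prems by (simp add: psd_def)
    have "D $ k = 0"
      using pos by (simp add: D_def outer_def w_def vec_eq_iff)
    moreover have "D $ i = 0" if "C $ i = 0" for i
    proof -
      have "w $ i = 0" using that symmetric_matrix_entry[OF sym, of k i] by (simp add: w_def)
      then show ?thesis using that by (simp add: D_def outer_def vec_eq_iff)
    qed
    ultimately have "{i. D $ i \<noteq> 0} \<subset> {i. C $ i \<noteq> 0}" using k by auto
    then have "card {i. D $ i \<noteq> 0} < card {i. C $ i \<noteq> 0}"
      by (simp add: psubset_card_mono)
    from less.hyps[OF this D] have "0 \<le> trace (A ** C) - w \<bullet> (A *v w)"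
      by (simp add: D_def trace_mult_diff trace_mult_outer)
    moreover have "0 \<le> w \<bullet> (A *v w)" using A by (simp add: psd_def)
    ultimately show ?thesis by linarith
  qed
qed

section \<open>The bordered matrix\<close>

lemma sum_UNIV_unit_plus:
  "(\<Sum>p\<in>(UNIV :: (unit + 'd::finite) set). f p) = f (Inl ()) + (\<Sum>i\<in>UNIV. f (Inr i))"
  by (simp add: UNIV_Plus_UNIV[symmetric] sum.Plus UNIV_unit del: UNIV_Plus_UNIV)

lemma psd_bordered_matrix_imp_psd_schur:
  assumes M: "psd (bordered_matrix u S)" and S: "symmetric_matrix S"
  shows "psd (S - outer u)"
proof -
  define M where "M = bordered_matrix u S"
  define N where "N = M - outer ((1 / sqrt (M $ Inl () $ Inl ())) *\<^sub>R (M $ Inl ()))"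
  have c: "M $ Inl () $ Inl () = 1" by (simp add: M_def bordered_matrix_def)
  have N: "psd N"
    unfolding N_def using M c by (intro psd_schur_complement) (simp_all add: M_def)
  have Nij: "N $ Inr i $ Inr j = (S - outer u) $ i $ j" for i j
    using c by (simp add: N_def outer_def) (simp add: M_def bordered_matrix_def)
  have "0 \<le> y \<bullet> ((S - outer u) *v y)" for y
  proof -
    \<comment> \<open>The block is a principal submatrix of \<open>N\<close>, so \<open>y\<close> is extended by zero.\<close>
    define z :: "real^(unit + 'a)" where "z = (\<chi> p. case p of Inl _ \<Rightarrow> 0 | Inr i \<Rightarrow> y $ i)"
    have "0 \<le> z \<bullet> (N *v z)" using N by (simp add: psd_def)
    also have "z \<bullet> (N *v z) = y \<bullet> ((S - outer u) *v y)"
      by (simp add: inner_vec_def matrix_vector_mult_def sum_UNIV_unit_plus Nij z_def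
          del: vector_minus_component)
    finally show ?thesis .
  qed
  moreover have "symmetric_matrix (S - outer u)"
    using S psd_outer[of u]
    by (simp add: psd_def symmetric_matrix_def transpose_def vec_eq_iff)
  ultimately show ?thesis by (simp add: psd_def)
qed

text \<open>The bordered matrix of \<open>(x, x x\<^sup>T)\<close> is the rank-one matrix of the vector \<open>(1, x)\<close>.\<close>

lemma psd_bordered_matrix_outer: "psd (bordered_matrix x (outer x))"
proof -
  have "bordered_matrix x (outer x) = outer (\<chi> p. case p of Inl _ \<Rightarrow> 1 | Inr i \<Rightarrow> x $ i)"
    by (auto simp: bordered_matrix_def outer_def vec_eq_iff split: sum.split)
  then show ?thesis by (simp add: psd_outer)
qed

section \<open>Exactness of the relaxation\<close>

lemma sdp_feasible_outer:
  assumes "x \<in> quad_region s A b r"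
  shows "sdp_feasible s A b r (x, outer x)"
proof -
  have "symmetric_matrix (outer x)" using psd_outer[of x] by (simp add: psd_def)
  then show ?thesis
    using assms
    by (simp add: sdp_feasible_def psd_bordered_matrix_outer trace_mult_outer quad_region_def)
qed

lemma sdp_objective_outer: "sdp_objective v (x, outer x) = (dist v x)\<^sup>2"
proof -
  have "trace (outer x) = x \<bullet> x"
    using trace_mult_outer[of "mat 1" x] by simp
  then show ?thesis
    by (simp add: sdp_objective_def dist_norm power2_norm_eq_inner inner_diff_left
        inner_diff_right inner_commute)
qed

lemma sdp_feasible_imp_mem_quad_region:
  assumes A: "\<And>j. j \<in> {1..s} \<Longrightarrow> psd (A j)" and f: "sdp_feasible s A b r (u, S)"
  shows "u \<in> quad_region s A b r"
proof -
  have C: "psd (S - outer u)"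
    using f by (auto simp: sdp_feasible_def intro: psd_bordered_matrix_imp_psd_schur)
  have "u \<bullet> (A j *v u) + b j \<bullet> u + r j \<le> 0" if j: "j \<in> {1..s}" for j
  proof -
    have "u \<bullet> (A j *v u) \<le> trace (A j ** S)"
      using trace_mult_psd_nonneg[OF A[OF j] C] by (simp add: trace_mult_diff trace_mult_outer)
    moreover have "trace (A j ** S) + b j \<bullet> u + r j \<le> 0"
      using f j by (simp add: sdp_feasible_def)
    ultimately show ?thesis by linarith
  qed
  then show ?thesis by (simp add: quad_region_def)
qed

lemma sdp_objective_ge_dist:
  assumes "sdp_feasible s A b r (u, S)"
  shows "(dist v u)\<^sup>2 \<le> sdp_objective v (u, S)"
proof -
  have "psd (S - outer u)"
    using assms by (auto simp: sdp_feasible_def intro: psd_bordered_matrix_imp_psd_schur)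
  moreover have "psd (mat 1 :: real^'a^'a)"
    by (simp add: psd_def symmetric_matrix_def transpose_mat)
  ultimately have "0 \<le> trace (mat 1 ** (S - outer u))"
    by (intro trace_mult_psd_nonneg)
  then have "trace (outer u) \<le> trace S"
    by (simp add: trace_sub)
  then have "sdp_objective v (u, outer u) \<le> sdp_objective v (u, S)"
    by (simp add: sdp_objective_def)
  then show ?thesis by (simp add: sdp_objective_outer)
qed

section \<open>Geometry of the region\<close>

lemma convex_quad_region:
  assumes A: "\<And>j. j \<in> {1..s} \<Longrightarrow> psd (A j)"
  shows "convex (quad_region s A b r)"
proof (rule convexI)
  fix x y and p q :: real
  assume x: "x \<in> quad_region s A b r" and y: "y \<in> quad_region s A b r"
    and p: "0 \<le> p" and q: "0 \<le> q" and pq: "p + q = 1"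
  have "(p *\<^sub>R x + q *\<^sub>R y) \<bullet> (A j *v (p *\<^sub>R x + q *\<^sub>R y)) + b j \<bullet> (p *\<^sub>R x + q *\<^sub>R y) + r j \<le> 0"
    if j: "j \<in> {1..s}" for j
  proof -
    let ?Q = "\<lambda>x. x \<bullet> (A j *v x)" and ?f = "\<lambda>x. x \<bullet> (A j *v x) + b j \<bullet> x + r j"
    let ?z = "p *\<^sub>R x + q *\<^sub>R y" and ?c = "x \<bullet> (A j *v y) + y \<bullet> (A j *v x)"
    have q': "q = 1 - p" using pq by simp
    have "?Q ?z = p * p * ?Q x + q * q * ?Q y + p * q * ?c"
      by (simp add: matrix_vector_right_distrib matrix_vector_mult_scaleR inner_add_left
          inner_add_right distrib_left distrib_right mult.assoc mult.left_commute[of q p])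
    moreover have "?Q (x - y) = ?Q x + ?Q y - ?c"
      by (simp add: matrix_vector_mult_diff_distrib inner_diff_left inner_diff_right)
    moreover have "b j \<bullet> ?z = p * (b j \<bullet> x) + q * (b j \<bullet> y)"
      by (simp add: inner_add_right)
    \<comment> \<open>The convexity defect of a quadratic function is a multiple of its quadratic form.\<close>
    ultimately have "?f ?z = p * ?f x + q * ?f y - p * q * ?Q (x - y)"
      using q' by algebra
    moreover have "0 \<le> p * q * ?Q (x - y)"
      using A[OF j] p q by (simp add: psd_def)
    moreover have "p * ?f x \<le> 0" "q * ?f y \<le> 0"
      using x y j p q by (auto simp: quad_region_def intro!: mult_nonneg_nonpos)
    ultimately show ?thesis by linarith
  qed
  then show "p *\<^sub>R x + q *\<^sub>R y \<in> quad_region s A b r" by (simp add: quad_region_def)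
qed

lemma closed_quad_region: "closed (quad_region s A b r)"
proof -
  have "quad_region s A b r =
      (\<Inter>j\<in>{1..s}. {x. x \<bullet> (A j *v x) + b j \<bullet> x + r j \<le> 0})"
    by (auto simp: quad_region_def)
  moreover have "closed {x. x \<bullet> (A j *v x) + b j \<bullet> x + r j \<le> 0}" for j
    by (intro closed_Collect_le continuous_on_add continuous_on_inner continuous_on_id
        continuous_on_const matrix_vector_mult_linear_continuous_on)
  ultimately show ?thesis by (simp add: closed_INT)
qed

section \<open>The projection\<close>

theorem theorem4p3:
  fixes v :: "real^'d" and s :: nat
    and A :: "nat \<Rightarrow> real^'d^'d" and b :: "nat \<Rightarrow> real^'d" and r :: "nat \<Rightarrow> real"
    and u\<^sub>v :: "real^'d" and S\<^sub>v :: "real^'d^'d"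
  assumes "\<And>j. j \<in> {1..s} \<Longrightarrow> psd (A j)"
    and "is_arg_min (sdp_objective v) (sdp_feasible s A b r) (u\<^sub>v, S\<^sub>v)"
  shows "closest_point (quad_region s A b r) v = u\<^sub>v"
proof -
  let ?D = "quad_region s A b r"
  have feas: "sdp_feasible s A b r (u\<^sub>v, S\<^sub>v)"
    using assms(2) by (simp add: is_arg_min_linorder)
  have opt: "sdp_objective v (u\<^sub>v, S\<^sub>v) \<le> sdp_objective v p" if "sdp_feasible s A b r p" for p
    using assms(2) that by (cases p) (simp add: is_arg_min_linorder)
  have near: "dist v u\<^sub>v \<le> dist v x" if "x \<in> ?D" for x
  proof -
    have "(dist v u\<^sub>v)\<^sup>2 \<le> sdp_objective v (u\<^sub>v, S\<^sub>v)"
      by (rule sdp_objective_ge_dist[OF feas])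
    also have "\<dots> \<le> sdp_objective v (x, outer x)"
      by (rule opt[OF sdp_feasible_outer[OF that]])
    also have "\<dots> = (dist v x)\<^sup>2" by (rule sdp_objective_outer)
    finally show ?thesis by (rule power2_le_imp_le) simp
  qed
  have "u\<^sub>v \<in> ?D"
    by (rule sdp_feasible_imp_mem_quad_region[OF assms(1) feas])
  with near have "u\<^sub>v = closest_point ?D v"
    using convex_quad_region[OF assms(1)] closed_quad_region
    by (intro closest_point_unique ballI)
  then show ?thesis by (rule sym)
qed

end
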